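(* Let $\Gamma$ be a discrete subgroup of $SL(2,\mathbb{R})$, let $m$ be a positive integer and $\xi$ an integer with $\xi > 2m \geq 2$, and let $F(z,X) \in QP^m_\xi(\Gamma)$. Then for each integer $\delta \geq 0$ there exists a Jacobi-like form $\Phi(z,X) \in \mathcal{J}_{\xi-2m-2\delta}(\Gamma)_\delta$ such that $\Pi^\delta_m \Phi = F$.
   Context: Let $\mathcal{H}$ be the Poincaré upper half plane and $\mathcal{F}$ the ring of holomorphic functions on $\mathcal{H}$. For $\gamma = \begin{pmatrix} a&b\\ c&d\end{pmatrix} \in SL(2,\mathbb{R})$ and $z\in\mathcal{H}$ put $\gamma z = (az+b)/(cz+d)$, $\mathfrak{J}(\gamma,z) = cz+d$, $\mathfrak{K}(\gamma,z) = c/(cz+d)$. Let $\mathcal{F}[[X]]$ be the algebra of formal power series in $X$ with coefficients in $\mathcal{F}$, and for an integer $\delta\ge 0$ let $\mathcal{F}[[X]]_\delta = X^\delta \mathcal{F}[[X]]$. Let $\mathcal{F}_m[X]$ be the space of polynomials in $X$ of degree at most $m$ with coefficients in $\mathcal{F}$. For $\lambda\in\mathbb{Z}$, $\Phi\in\mathcal{F}[[X]]$, $F\in\mathcal{F}_m[X]$ define $(\Phi\mid^J_\lambda \gamma)(z,X) = \mathfrak{J}(\gamma,z)^{-\lambda} e^{-\mathfrak{K}(\gamma,z)X}\Phi(\gamma z, \mathfrak{J}(\gamma,z)^{-2}X)$ and $(F\,\|_\lambda\, \gamma)(z,X) = \mathfrak{J}(\gamma,z)^{-\lambda} F(\gamma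 z, \mathfrak{J}(\gamma,z)^2(X-\mathfrak{K}(\gamma,z)))$. $QP^m_\xi(\Gamma)$ denotes the set of $F\in\mathcal{F}_m[X]$ with $F\,\|_\xi\,\gamma = F$ for all $\gamma\in\Gamma$ (quasimodular polynomials). $\mathcal{J}_\lambda(\Gamma)_\delta$ denotes the set of $\Phi\in\mathcal{F}[[X]]_\delta$ with $\Phi\mid^J_\lambda\gamma = \Phi$ for all $\gamma\in\Gamma$ (Jacobi-like forms of weight $\lambda$). For $\Phi(z,X) = \sum_{k\ge 0}\phi_k(z)X^{k+\delta}\in\mathcal{F}[[X]]_\delta$ and $m\ge 0$ define $(\Pi^\delta_m\Phi)(z,X) = \sum_{r=0}^m \frac{1}{r!}\phi_{m-r}(z)X^r \in \mathcal{F}_m[X]$. *)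

theory Defs
  imports
    "HOL-Analysis.Analysis"
    "HOL-Algebra.Group"
    "HOL-Computational_Algebra.Computational_Algebra"
begin

definition SL2R :: "(real^2^2) monoid" where
  "SL2R = \<lparr>carrier = {A. det A = 1}, monoid.mult = (**), one = mat 1\<rparr>"

lemma group_SL2R: "group SL2R"
proof (rule groupI)
  fix A assume A: "A \<in> carrier SL2R"
  then have d: "det A = 1" by (simp add: SL2R_def)
  then have "invertible A" by (simp add: invertible_det_nz)
  then obtain B where B: "B ** A = mat 1"
    by (auto simp: invertible_def)
  have "det B * det A = 1"
    by (metis B det_I det_mul)
  with d B show "\<exists>B\<in>carrier SL2R. B \<otimes>\<^bsub>SL2R\<^esub> A = \<one>\<^bsub>SL2R\<^esub>"
    by (auto simp: SL2R_def)
qed (auto simp: SL2R_def det_mul matrix_mul_assoc)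

text \<open>\<^const>\<open>discrete\<close> says that every point is isolated, i.e. that the topology induced
  from the space of real matrices is the discrete one.\<close>

definition discrete_subgroup_SL2R :: "(real^2^2) set \<Rightarrow> bool" where
  "discrete_subgroup_SL2R \<Gamma> \<longleftrightarrow> subgroup \<Gamma> SL2R \<and> discrete \<Gamma>"

definition upper_half_plane :: "complex set" where
  "upper_half_plane = {z. Im z > 0}"

definition mobius :: "real^2^2 \<Rightarrow> complex \<Rightarrow> complex" where
  "mobius \<gamma> z = (of_real (\<gamma>$1$1) * z + of_real (\<gamma>$1$2)) / (of_real (\<gamma>$2$1) * z + of_real (\<gamma>$2$2))"

definition cocycle_J :: "real^2^2 \<Rightarrow> complex \<Rightarrow> complex" where
  "cocycle_J \<gamma> z = of_real (\<gamma>$2$1) * z + of_real (\<gamma>$2$2)"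

definition cocycle_K :: "real^2^2 \<Rightarrow> complex \<Rightarrow> complex" where
  "cocycle_K \<gamma> z = of_real (\<gamma>$2$1) / (of_real (\<gamma>$2$1) * z + of_real (\<gamma>$2$2))"

text \<open>
  A formal power series (polynomial) in \<open>X\<close> over the ring of holomorphic functions on the upper
  half plane is encoded as the family, indexed by \<open>z\<close>, of the complex power series (polynomials)
  obtained by evaluating its coefficients at \<open>z\<close>.  Values at points \<open>z\<close> outside the upper half
  plane are irrelevant: two families represent the same object iff they agree on the upper half
  plane, and all conditions below only look there.
\<close>

definition hol_fps :: "(complex \<Rightarrow> complex fps) set" where
  "hol_fps = {\<Phi>. \<forall>n. (\<lambda>z. fps_nth (\<Phi> z) n) holomorphic_on upper_half_plane}"

definition hol_fps_ge :: "nat \<Rightarrow> (complex \<Rightarrow> complex fps) set" where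
  "hol_fps_ge \<delta> =
    {\<Phi>. \<exists>\<Psi>\<in>hol_fps. \<forall>z\<in>upper_half_plane. \<Phi> z = fps_X ^ \<delta> * \<Psi> z}"

definition hol_poly :: "nat \<Rightarrow> (complex \<Rightarrow> complex poly) set" where
  "hol_poly m =
    {F. (\<forall>n. (\<lambda>z. coeff (F z) n) holomorphic_on upper_half_plane) \<and>
        (\<forall>z\<in>upper_half_plane. degree (F z) \<le> m)}"

definition jacobi_slash ::
    "int \<Rightarrow> (complex \<Rightarrow> complex fps) \<Rightarrow> real^2^2 \<Rightarrow> complex \<Rightarrow> complex fps" where
  "jacobi_slash w \<Phi> \<gamma> z =
     fps_const (cocycle_J \<gamma> z powi (- w)) * fps_exp (- cocycle_K \<gamma> z) *
     fps_compose (\<Phi> (mobius \<gamma> z)) (fps_const (cocycle_J \<gamma> z powi (- 2)) * fps_X)"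

definition poly_slash ::
    "int \<Rightarrow> (complex \<Rightarrow> complex poly) \<Rightarrow> real^2^2 \<Rightarrow> complex \<Rightarrow> complex poly" where
  "poly_slash w F \<gamma> z =
     smult (cocycle_J \<gamma> z powi (- w))
       (pcompose (F (mobius \<gamma> z)) (smult ((cocycle_J \<gamma> z)\<^sup>2) [:- cocycle_K \<gamma> z, 1:]))"

definition quasimodular_polys ::
    "nat \<Rightarrow> int \<Rightarrow> (real^2^2) set \<Rightarrow> (complex \<Rightarrow> complex poly) set" where
  "quasimodular_polys m \<xi> \<Gamma> =
    {F \<in> hol_poly m. \<forall>\<gamma>\<in>\<Gamma>. \<forall>z\<in>upper_half_plane. poly_slash \<xi> F \<gamma> z = F z}"

definition jacobi_like_forms ::
    "int \<Rightarrow> (real^2^2) set \<Rightarrow> nat \<Rightarrow> (complex \<Rightarrow> complex fps) set" where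
  "jacobi_like_forms w \<Gamma> \<delta> =
    {\<Phi> \<in> hol_fps_ge \<delta>. \<forall>\<gamma>\<in>\<Gamma>. \<forall>z\<in>upper_half_plane. jacobi_slash w \<Phi> \<gamma> z = \<Phi> z}"

text \<open>The coefficient \<open>\<phi>\<^sub>k\<close> of \<open>\<Phi> = (\<Sum>k. \<phi>\<^sub>k X\<^bsup>k+\<delta>\<^esup>)\<close> sits at index \<open>k + \<delta>\<close>.\<close>

definition jacobi_proj ::
    "nat \<Rightarrow> nat \<Rightarrow> (complex \<Rightarrow> complex fps) \<Rightarrow> complex \<Rightarrow> complex poly" where
  "jacobi_proj \<delta> m \<Phi> z =
     (\<Sum>r=0..m. monom (1 / fact r * fps_nth (\<Phi> z) (m - r + \<delta>)) r)"

end

theory Submission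
  imports Defs "HOL-Complex_Analysis.Cauchy_Integral_Formula"
begin

text \<open>
  With \<open>w = \<xi> - 2m > 0\<close>, put \<open>\<phi>\<^sub>k = (m - k)! f\<^bsub>m-k\<^esub>\<close> for \<open>F = \<Sum>\<^sub>r f\<^sub>r X\<^sup>r\<close> and \<open>k \<le> m\<close>.  Invariance
  of \<open>F\<close> and of a Jacobi-like form are the same coefficient law
  \<open>\<phi>\<^sub>k(\<gamma>z) = J\<^bsup>w+2k\<^esup> \<Sum>\<^sub>j K\<^sup>j \<phi>\<^bsub>k-j\<^esub>(z) / j!\<close>, imposed for \<open>k \<le> m\<close> and for all \<open>k\<close>
  respectively, so a finite sequence obeying the law has to be prolonged.  Its first term is
  modular of weight \<open>w\<close>; since \<open>w > 0\<close> it has a Cohen--Kuznetsov lift, which is an infinite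
  sequence obeying the law.  Subtracting the lift kills the first term, and shifting the remainder
  gives a shorter sequence obeying the law of weight \<open>w + 2\<close>.
\<close>

section \<open>The action on the half plane and the derivatives of its cocycles\<close>

lemma open_upper_half_plane: "open upper_half_plane"
  unfolding upper_half_plane_def by (rule open_halfspace_Im_gt)

lemma cocycle_J_nonzero:
  assumes "det \<gamma> = 1" "z \<in> upper_half_plane"
  shows "cocycle_J \<gamma> z \<noteq> 0"
proof
  assume J: "cocycle_J \<gamma> z = 0"
  then have "\<gamma>$2$1 * Im z = 0"
    by (auto simp: cocycle_J_def complex_eq_iff)
  with assms have c: "\<gamma>$2$1 = 0"
    by (simp add: upper_half_plane_def)
  with J have "\<gamma>$2$2 = 0"
    by (simp add: cocycle_J_def)
  with c assms show False by (simp add: det_2)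
qed

lemma Im_mobius:
  assumes "det \<gamma> = 1"
  shows "Im (mobius \<gamma> z) = Im z / (cmod (cocycle_J \<gamma> z))\<^sup>2"
proof -
  have "Im (mobius \<gamma> z) = (\<gamma>$1$1 * \<gamma>$2$2 - \<gamma>$1$2 * \<gamma>$2$1) * Im z / (cmod (cocycle_J \<gamma> z))\<^sup>2"
    unfolding mobius_def cocycle_J_def by (simp add: Im_divide cmod_power2 algebra_simps)
  with assms show ?thesis by (simp add: det_2)
qed

lemma mobius_upper_half_plane:
  assumes "det \<gamma> = 1" "z \<in> upper_half_plane"
  shows "mobius \<gamma> z \<in> upper_half_plane"
  using assms cocycle_J_nonzero[OF assms] Im_mobius[OF assms(1), of z]
  by (simp add: upper_half_plane_def)

text \<open>\<open>cocycle_K\<close> is the logarithmic derivative of \<open>cocycle_J\<close>. With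
  the two derivatives that follow, differentiation stays within expressions in these cocycles, free
  of matrix entries.\<close>

lemma cocycle_J_has_field_derivative:
  assumes "det \<gamma> = 1" "z \<in> upper_half_plane"
  shows "(cocycle_J \<gamma> has_field_derivative cocycle_K \<gamma> z * cocycle_J \<gamma> z) (at z)"
proof -
  have "cocycle_K \<gamma> z * cocycle_J \<gamma> z = of_real (\<gamma>$2$1)"
    using cocycle_J_nonzero[OF assms] by (simp add: cocycle_K_def cocycle_J_def)
  then show ?thesis
    unfolding cocycle_J_def[abs_def] by (auto intro!: derivative_eq_intros)
qed

lemma cocycle_K_has_field_derivative:
  assumes "det \<gamma> = 1" "z \<in> upper_half_plane"
  shows "(cocycle_K \<gamma> has_field_derivative - (cocycle_K \<gamma> z)\<^sup>2) (at z)"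
  using cocycle_J_nonzero[OF assms] unfolding cocycle_K_def[abs_def] cocycle_J_def
  by (auto intro!: derivative_eq_intros simp: power2_eq_square field_simps)

lemma mobius_has_field_derivative:
  assumes "det \<gamma> = 1" "z \<in> upper_half_plane"
  shows "(mobius \<gamma> has_field_derivative inverse ((cocycle_J \<gamma> z)\<^sup>2)) (at z)"
proof -
  let ?a = "complex_of_real (\<gamma>$1$1)" and ?b = "complex_of_real (\<gamma>$1$2)"
  let ?c = "complex_of_real (\<gamma>$2$1)" and ?d = "complex_of_real (\<gamma>$2$2)"
  have nz: "?c * z + ?d \<noteq> 0"
    using cocycle_J_nonzero[OF assms] by (simp add: cocycle_J_def)
  have "?a * ?d - ?b * ?c = 1"
    using assms(1) by (simp add: det_2 flip: of_real_mult of_real_diff)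
  then have "?a * (?c * z + ?d) - (?a * z + ?b) * ?c = 1"
    by algebra
  moreover have "(mobius \<gamma> has_field_derivative
      (?a * (?c * z + ?d) - (?a * z + ?b) * ?c) / ((?c * z + ?d) * (?c * z + ?d))) (at z)"
    unfolding mobius_def[abs_def] using nz by (auto intro!: derivative_eq_intros)
  ultimately show ?thesis
    by (simp add: cocycle_J_def power2_eq_square divide_inverse)
qed

section \<open>The coefficient law and the Cohen-Kuznetsov lift\<close>

text \<open>The invariance of \<open>\<Sum>\<^sub>k \<phi>\<^sub>k X\<^bsup>k+\<delta>\<^esup>\<close> under the weight \<open>w - 2\<delta>\<close> action, read off
  coefficient by coefficient; \<open>\<delta>\<close> drops out.\<close>

definition jacobi_law :: "int \<Rightarrow> real^2^2 \<Rightarrow> (nat \<Rightarrow> complex \<Rightarrow> complex) \<Rightarrow> nat \<Rightarrow> bool" where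
  "jacobi_law w \<gamma> \<phi> k \<longleftrightarrow> (\<forall>z\<in>upper_half_plane.
     \<phi> k (mobius \<gamma> z) = cocycle_J \<gamma> z powi (w + 2 * int k) *
       (\<Sum>j\<le>k. cocycle_K \<gamma> z ^ j / fact j * \<phi> (k - j) z))"

text \<open>The Cohen--Kuznetsov lift \<open>f\<^bsup>(k)\<^esup> / (k! w(w+1)\<dots>(w+k-1))\<close>.\<close>

fun cohen_kuznetsov :: "int \<Rightarrow> (complex \<Rightarrow> complex) \<Rightarrow> nat \<Rightarrow> complex \<Rightarrow> complex" where
  "cohen_kuznetsov w f 0 = f"
| "cohen_kuznetsov w f (Suc k) =
     (\<lambda>z. deriv (cohen_kuznetsov w f k) z / (of_nat (Suc k) * of_int (w + int k)))"

lemma holomorphic_cohen_kuznetsov: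
  "f holomorphic_on upper_half_plane \<Longrightarrow> cohen_kuznetsov w f k holomorphic_on upper_half_plane"
proof (induction k)
  case (Suc k)
  then have "(\<lambda>z. deriv (cohen_kuznetsov w f k) z *
      inverse (of_nat (Suc k) * of_int (w + int k))) holomorphic_on upper_half_plane"
    by (intro holomorphic_intros holomorphic_deriv open_upper_half_plane)
  then show ?case by (simp only: cohen_kuznetsov.simps divide_inverse)
qed simp

text \<open>The identity behind the lift:
  \<open>(k + 1 - j)(w + k - j) + j(w + 2k) - j(j - 1) = (k + 1)(w + k)\<close>
  is what remains at \<open>K\<^sup>j \<phi>\<^bsub>k+1-j\<^esub> / j!\<close> after differentiating the law for \<open>k\<close>.\<close>

lemma lift_sum_identity:
  fixes K w :: complex and \<phi> d :: "nat \<Rightarrow> complex"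
  assumes d: "\<And>i. i \<le> k \<Longrightarrow> d i = of_nat (Suc i) * (w + of_nat i) * \<phi> (Suc i)"
  shows "(w + 2 * of_nat k) * K * (\<Sum>j\<le>k. K ^ j / fact j * \<phi> (k - j))
      + (\<Sum>j\<le>k. K ^ j / fact j * d (k - j) - of_nat j * K ^ Suc j / fact j * \<phi> (k - j))
    = of_nat (Suc k) * (w + of_nat k) * (\<Sum>j\<le>Suc k. K ^ j / fact j * \<phi> (Suc k - j))"
proof -
  let ?t = "\<lambda>j. K ^ j / fact j * \<phi> (Suc k - j)"
  let ?q = "\<lambda>j. of_nat j * (w + 2 * of_nat k - of_nat j + 1) :: complex"
  \<comment> \<open>Raising the index turns \<open>1 / fact j\<close> into
    \<open>of_nat (Suc j) / fact (Suc j)\<close>. This numerator is the factor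
    \<open>of_nat j\<close> of \<open>?q\<close>, which also kills the term at
    \<open>j = 0\<close>.\<close>
  have shift: "(\<Sum>j\<le>k. (w + 2 * of_nat k - of_nat j) * (K ^ Suc j / fact j * \<phi> (k - j)))
      = (\<Sum>j\<le>Suc k. ?q j * ?t j)"
  proof -
    have "(\<Sum>j\<le>Suc k. ?q j * ?t j) = (\<Sum>j\<le>k. ?q (Suc j) * ?t (Suc j))"
      by (subst sum.atMost_Suc_shift) simp
    also have "\<dots> = (\<Sum>j\<le>k. (w + 2 * of_nat k - of_nat j) * (K ^ Suc j / fact j * \<phi> (k - j)))"
    proof (rule sum.cong[OF refl])
      fix j
      have "of_nat (Suc j) / fact (Suc j) = (1 / fact j :: complex)"
        by (simp add: field_simps del: of_nat_Suc)
      moreover have "?q (Suc j) * ?t (Suc j) = (w + 2 * of_nat k - of_nat j) * K ^ Suc j *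
          (of_nat (Suc j) / fact (Suc j)) * \<phi> (k - j)"
      proof -
        have "?q (Suc j) = of_nat (Suc j) * (w + 2 * of_nat k - of_nat j)"
          by simp
        then show ?thesis by (simp only: divide_inverse mult_ac diff_Suc_Suc)
      qed
      ultimately show "?q (Suc j) * ?t (Suc j) =
          (w + 2 * of_nat k - of_nat j) * (K ^ Suc j / fact j * \<phi> (k - j))"
        by simp
    qed
    finally show ?thesis by simp
  qed
  have "(\<Sum>j\<le>k. K ^ j / fact j * d (k - j))
      = (\<Sum>j\<le>k. of_nat (Suc k - j) * (w + of_nat k - of_nat j) * ?t j)"
    by (intro sum.cong refl) (auto simp: d Suc_diff_le of_nat_diff)
  \<comment> \<open>The added term at \<open>j = Suc k\<close> has the coefficient
    \<open>of_nat 0\<close>.\<close>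
  also have "\<dots> = (\<Sum>j\<le>Suc k. of_nat (Suc k - j) * (w + of_nat k - of_nat j) * ?t j)"
    by simp
  finally have D: "(\<Sum>j\<le>k. K ^ j / fact j * d (k - j)) = \<dots>" .
  have "(w + 2 * of_nat k) * K * (\<Sum>j\<le>k. K ^ j / fact j * \<phi> (k - j))
      + (\<Sum>j\<le>k. K ^ j / fact j * d (k - j) - of_nat j * K ^ Suc j / fact j * \<phi> (k - j))
    = (\<Sum>j\<le>k. (w + 2 * of_nat k - of_nat j) * (K ^ Suc j / fact j * \<phi> (k - j)))
      + (\<Sum>j\<le>k. K ^ j / fact j * d (k - j))"
    unfolding sum_distrib_left sum.distrib[symmetric]
    by (intro sum.cong refl) (simp add: algebra_simps add_divide_distrib diff_divide_distrib)
  also have "\<dots> = (\<Sum>j\<le>Suc k. ?q j * ?t j + of_nat (Suc k - j) * (w + of_nat k - of_nat j) * ?t j)"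
    unfolding shift D by (rule sum.distrib[symmetric])
  also have "\<dots> = (\<Sum>j\<le>Suc k. of_nat (Suc k) * (w + of_nat k) * ?t j)"
  proof (intro sum.cong refl)
    fix j assume "j \<in> {..Suc k}"
    then have "(of_nat (Suc k - j) :: complex) = of_nat k + 1 - of_nat j"
      by (simp add: of_nat_diff)
    then have "?q j + of_nat (Suc k - j) * (w + of_nat k - of_nat j) =
        of_nat (Suc k) * (w + of_nat k)"
      by (simp only:) (simp add: algebra_simps)
    then show "?q j * ?t j + of_nat (Suc k - j) * (w + of_nat k - of_nat j) * ?t j
        = of_nat (Suc k) * (w + of_nat k) * ?t j"
      by (simp only: distrib_right[symmetric])
  qed
  finally show ?thesis by (simp only: sum_distrib_left)
qed

text \<open>Differentiate the law for \<open>k\<close>: the chain rule on the left and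
  \<open>lift_sum_identity\<close> on the right both produce the factor
  \<open>of_nat (Suc k) * of_int (w + int k)\<close>, nonzero since \<open>w > 0\<close>. The square
  of \<open>J\<close> in the chain rule raises the exponent by 2.\<close>

lemma jacobi_law_Suc:
  assumes \<gamma>: "det \<gamma> = 1" and w: "w > 0"
    and hol: "\<And>i. i \<le> k \<Longrightarrow> \<phi> i holomorphic_on upper_half_plane"
    and deriv: "\<And>i z. i \<le> k \<Longrightarrow> z \<in> upper_half_plane \<Longrightarrow>
      deriv (\<phi> i) z = of_nat (Suc i) * of_int (w + int i) * \<phi> (Suc i) z"
    and law: "jacobi_law w \<gamma> \<phi> k"
  shows "jacobi_law w \<gamma> \<phi> (Suc k)"
  unfolding jacobi_law_def
proof
  fix z assume z: "z \<in> upper_half_plane"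
  define J where "J = cocycle_J \<gamma> z"
  define K where "K = cocycle_K \<gamma> z"
  define e where "e = w + 2 * int k"
  define S where "S = (\<lambda>u. \<Sum>j\<le>k. cocycle_K \<gamma> u ^ j / fact j * \<phi> (k - j) u)"
  have J: "J \<noteq> 0" unfolding J_def by (rule cocycle_J_nonzero[OF \<gamma> z])
  have mz: "mobius \<gamma> z \<in> upper_half_plane" by (rule mobius_upper_half_plane[OF \<gamma> z])
  have D: "(\<phi> i has_field_derivative of_nat (Suc i) * of_int (w + int i) * \<phi> (Suc i) u) (at u)"
    if "i \<le> k" "u \<in> upper_half_plane" for i u
    using holomorphic_derivI[OF hol[OF that(1)] open_upper_half_plane that(2)] deriv[OF that]
    by simp
  have "((\<lambda>u. \<phi> k (mobius \<gamma> u)) has_field_derivative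
      of_nat (Suc k) * of_int (w + int k) * \<phi> (Suc k) (mobius \<gamma> z) * inverse (J\<^sup>2)) (at z)"
    unfolding J_def
    by (rule DERIV_chain2[OF D[OF order_refl mz] mobius_has_field_derivative[OF \<gamma> z]])
  then have L: "deriv (\<lambda>u. \<phi> k (mobius \<gamma> u)) z =
      of_nat (Suc k) * of_int (w + int k) * \<phi> (Suc k) (mobius \<gamma> z) * inverse (J\<^sup>2)"
    by (rule DERIV_imp_deriv)
  have DJ: "((\<lambda>u. cocycle_J \<gamma> u powi e) has_field_derivative of_int e * K * J powi e) (at z)"
  proof -
    have "((\<lambda>u. cocycle_J \<gamma> u powi e) has_field_derivative of_int e * J powi (e - 1) * (K * J)) (at z)"
      unfolding J_def K_def
      by (rule DERIV_power_int[OF cocycle_J_has_field_derivative[OF \<gamma> z]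
          disjI2[OF cocycle_J_nonzero[OF \<gamma> z]]])
    moreover have "of_int e * J powi (e - 1) * (K * J) = of_int e * K * J powi e"
      using J by (simp add: power_int_diff)
    ultimately show ?thesis by simp
  qed
  have DS: "(S has_field_derivative (\<Sum>j\<le>k. K ^ j / fact j *
      (of_nat (Suc (k - j)) * of_int (w + int (k - j)) * \<phi> (Suc (k - j)) z)
      - of_nat j * K ^ Suc j / fact j * \<phi> (k - j) z)) (at z)" (is "(_ has_field_derivative ?S') _")
    unfolding S_def
  proof (rule DERIV_sum)
    fix j
    \<comment> \<open>The power rule leaves the truncated exponent \<open>j - 1\<close>, which
      combines with the square of \<open>K\<close> to \<open>Suc j\<close> only for positive
      \<open>j\<close>; at \<open>j = 0\<close> the factor \<open>of_nat j\<close> vanishes. Hence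
      the case split.\<close>
    have P: "((\<lambda>u. cocycle_K \<gamma> u ^ j / fact j) has_field_derivative - (of_nat j * K ^ Suc j / fact j)) (at z)"
      unfolding K_def
      by (rule derivative_eq_intros cocycle_K_has_field_derivative[OF \<gamma> z] refl | simp)+
        (cases j; simp add: power2_eq_square mult_ac)
    show "((\<lambda>u. cocycle_K \<gamma> u ^ j / fact j * \<phi> (k - j) u) has_field_derivative K ^ j / fact j *
      (of_nat (Suc (k - j)) * of_int (w + int (k - j)) * \<phi> (Suc (k - j)) z)
      - of_nat j * K ^ Suc j / fact j * \<phi> (k - j) z) (at z)"
      by (rule DERIV_cong[OF DERIV_mult[OF P D[OF diff_le_self z]]]) (simp add: K_def)
  qed
  have "((\<lambda>u. cocycle_J \<gamma> u powi e * S u) has_field_derivative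
      J powi e * (of_int e * K * S z + ?S')) (at z)"
    by (rule DERIV_cong[OF DERIV_mult[OF DJ DS]]) (simp add: J_def algebra_simps)
  then have R: "deriv (\<lambda>u. cocycle_J \<gamma> u powi e * S u) z = J powi e * (of_int e * K * S z + ?S')"
    by (rule DERIV_imp_deriv)
  \<comment> \<open>The law equates the two functions on an open neighbourhood of \<open>z\<close>,
    so their derivatives agree there.\<close>
  have "deriv (\<lambda>u. \<phi> k (mobius \<gamma> u)) z = deriv (\<lambda>u. cocycle_J \<gamma> u powi e * S u) z"
    using law eventually_nhds_in_open[OF open_upper_half_plane z]
    by (intro deriv_cong_ev) (auto simp: jacobi_law_def S_def e_def elim!: eventually_mono)
  moreover have "of_int e * K * S z + ?S' = of_nat (Suc k) * of_int (w + int k) *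
      (\<Sum>j\<le>Suc k. K ^ j / fact j * \<phi> (Suc k - j) z)"
    using lift_sum_identity[where w = "of_int w" and \<phi> = "\<lambda>i. \<phi> i z" and k = k and K = K and
        d = "\<lambda>i. of_nat (Suc i) * of_int (w + int i) * \<phi> (Suc i) z"]
    by (simp add: S_def K_def e_def)
  ultimately have "of_nat (Suc k) * of_int (w + int k) * (\<phi> (Suc k) (mobius \<gamma> z) * inverse (J\<^sup>2)) =
      of_nat (Suc k) * of_int (w + int k) *
      (J powi e * (\<Sum>j\<le>Suc k. K ^ j / fact j * \<phi> (Suc k - j) z))"
    unfolding L R by (simp only: mult_ac)
  moreover have "of_nat (Suc k) * of_int (w + int k) \<noteq> (0 :: complex)"
    using w by (simp only: mult_eq_0_iff of_nat_eq_0_iff of_int_eq_0_iff) simp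
  ultimately have "\<phi> (Suc k) (mobius \<gamma> z) * inverse (J\<^sup>2) =
      J powi e * (\<Sum>j\<le>Suc k. K ^ j / fact j * \<phi> (Suc k - j) z)"
    by (simp only: mult_cancel_left simp_thms)
  moreover have "J powi (w + 2 * int (Suc k)) = J powi e * J\<^sup>2"
    using J power_int_add[of J e 2] by (simp add: e_def algebra_simps)
  ultimately show "\<phi> (Suc k) (mobius \<gamma> z) = cocycle_J \<gamma> z powi (w + 2 * int (Suc k)) *
      (\<Sum>j\<le>Suc k. cocycle_K \<gamma> z ^ j / fact j * \<phi> (Suc k - j) z)"
    using J unfolding J_def[symmetric] K_def[symmetric] by (simp add: field_simps)
qed

text \<open>The law at 0 is modularity of \<open>f\<close>. Each further step is
  \<open>jacobi_law_Suc\<close>, whose derivative hypothesis is the recursion of the lift with its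
  denominator cleared; \<open>w > 0\<close> keeps that denominator nonzero.\<close>

lemma jacobi_law_cohen_kuznetsov:
  assumes \<gamma>: "det \<gamma> = 1" and w: "w > 0" and f: "f holomorphic_on upper_half_plane"
    and inv: "\<And>z. z \<in> upper_half_plane \<Longrightarrow> f (mobius \<gamma> z) = cocycle_J \<gamma> z powi w * f z"
  shows "jacobi_law w \<gamma> (cohen_kuznetsov w f) k"
proof (induction k)
  case 0
  show ?case using inv by (simp add: jacobi_law_def)
next
  case (Suc k)
  have "deriv (cohen_kuznetsov w f i) z =
      of_nat (Suc i) * of_int (w + int i) * cohen_kuznetsov w f (Suc i) z" for i z
  proof -
    have "of_nat (Suc i) * of_int (w + int i) \<noteq> (0 :: complex)"
      using w by (simp only: mult_eq_0_iff of_nat_eq_0_iff of_int_eq_0_iff) simp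
    then show ?thesis by (simp del: of_nat_Suc of_int_add)
  qed
  then show ?case
    by (intro jacobi_law_Suc[OF \<gamma> w _ _ Suc.IH] holomorphic_cohen_kuznetsov f)
qed

section \<open>Prolonging a finite sequence that obeys the law\<close>

lemma jacobi_law_diff:
  assumes "jacobi_law w \<gamma> \<phi> k" "jacobi_law w \<gamma> \<psi> k"
  shows "jacobi_law w \<gamma> (\<lambda>i z. \<phi> i z - \<psi> i z) k"
  using assms by (auto simp: jacobi_law_def sum_subtractf algebra_simps)

lemma jacobi_law_add:
  assumes "jacobi_law w \<gamma> \<phi> k" "jacobi_law w \<gamma> \<psi> k"
  shows "jacobi_law w \<gamma> (\<lambda>i z. \<phi> i z + \<psi> i z) k"
  using assms by (auto simp: jacobi_law_def sum.distrib algebra_simps)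

text \<open>The term \<open>j = Suc k\<close> contains \<open>\<phi> 0\<close> and drops out, and
  the exponents agree because w + 2(k + 1) = (w + 2) + 2k.\<close>

lemma jacobi_law_Suc_iff:
  assumes "\<And>z. z \<in> upper_half_plane \<Longrightarrow> \<phi> 0 z = 0"
  shows "jacobi_law w \<gamma> \<phi> (Suc k) \<longleftrightarrow> jacobi_law (w + 2) \<gamma> (\<lambda>i. \<phi> (Suc i)) k"
proof -
  have "(\<Sum>j\<le>Suc k. cocycle_K \<gamma> z ^ j / fact j * \<phi> (Suc k - j) z) =
      (\<Sum>j\<le>k. cocycle_K \<gamma> z ^ j / fact j * \<phi> (Suc (k - j)) z)" if "z \<in> upper_half_plane" for z
    using assms[OF that] by (auto simp: Suc_diff_le intro!: sum.cong)
  then show ?thesis by (simp add: jacobi_law_def algebra_simps)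
qed

text \<open>Induction on \<open>m\<close> with \<open>w\<close> and \<open>\<phi>\<close> free,
  since each round raises the weight by 2 and so keeps it positive. The construction uses
  \<open>w\<close> and \<open>\<phi>\<close> but never \<open>\<gamma>\<close>, so one
  \<open>\<psi>\<close> serves all of \<open>\<Gamma>\<close>.\<close>

lemma jacobi_law_extend:
  assumes "\<And>\<gamma>. \<gamma> \<in> \<Gamma> \<Longrightarrow> det \<gamma> = 1" "w > 0"
    and "\<And>k. k \<le> m \<Longrightarrow> \<phi> k holomorphic_on upper_half_plane"
    and "\<And>\<gamma> k. \<gamma> \<in> \<Gamma> \<Longrightarrow> k \<le> m \<Longrightarrow> jacobi_law w \<gamma> \<phi> k"
  shows "\<exists>\<psi>. (\<forall>k. \<psi> k holomorphic_on upper_half_plane) \<and>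
      (\<forall>\<gamma>\<in>\<Gamma>. \<forall>k. jacobi_law w \<gamma> \<psi> k) \<and> (\<forall>k\<le>m. \<psi> k = \<phi> k)"
  using assms(2-)
proof (induction m arbitrary: w \<phi>)
  case (0 w \<phi>)
  have "\<phi> 0 (mobius \<gamma> z) = cocycle_J \<gamma> z powi w * \<phi> 0 z"
    if "\<gamma> \<in> \<Gamma>" "z \<in> upper_half_plane" for \<gamma> z
    using 0(3)[OF that(1), of 0] that(2) by (simp add: jacobi_law_def)
  then have "jacobi_law w \<gamma> (cohen_kuznetsov w (\<phi> 0)) k" if "\<gamma> \<in> \<Gamma>" for \<gamma> k
    using that 0 assms(1) by (intro jacobi_law_cohen_kuznetsov) auto
  with 0 show ?case
    by (intro exI[of _ "cohen_kuznetsov w (\<phi> 0)"]) (auto intro: holomorphic_cohen_kuznetsov)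
next
  case (Suc m w \<phi>)
  let ?C = "cohen_kuznetsov w (\<phi> 0)"
  let ?\<chi> = "\<lambda>k z. \<phi> k z - ?C k z"
  have C: "?C k holomorphic_on upper_half_plane" for k
    using Suc.prems by (intro holomorphic_cohen_kuznetsov) auto
  have "\<phi> 0 (mobius \<gamma> z) = cocycle_J \<gamma> z powi w * \<phi> 0 z"
    if "\<gamma> \<in> \<Gamma>" "z \<in> upper_half_plane" for \<gamma> z
    using Suc.prems(3)[OF that(1), of 0] that(2) by (simp add: jacobi_law_def)
  then have lawC: "jacobi_law w \<gamma> ?C k" if "\<gamma> \<in> \<Gamma>" for \<gamma> k
    using that Suc.prems assms(1) by (intro jacobi_law_cohen_kuznetsov) auto
  have "\<exists>\<psi>. (\<forall>k. \<psi> k holomorphic_on upper_half_plane) \<and>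
      (\<forall>\<gamma>\<in>\<Gamma>. \<forall>k. jacobi_law (w + 2) \<gamma> \<psi> k) \<and> (\<forall>k\<le>m. \<psi> k = ?\<chi> (Suc k))"
  proof (rule Suc.IH)
    show "w + 2 > 0" using Suc.prems by simp
    show "?\<chi> (Suc k) holomorphic_on upper_half_plane" if "k \<le> m" for k
      using that by (intro holomorphic_on_diff Suc.prems(2) C) simp
    show "jacobi_law (w + 2) \<gamma> (\<lambda>k. ?\<chi> (Suc k)) k" if "\<gamma> \<in> \<Gamma>" "k \<le> m" for \<gamma> k
    proof -
      have "jacobi_law w \<gamma> ?\<chi> (Suc k)"
        using that Suc.prems(3) lawC by (intro jacobi_law_diff) auto
      then show ?thesis by (subst (asm) jacobi_law_Suc_iff) auto
    qed
  qed
  then obtain \<psi> where \<psi>: "\<And>k. \<psi> k holomorphic_on upper_half_plane"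
    "\<And>\<gamma> k. \<gamma> \<in> \<Gamma> \<Longrightarrow> jacobi_law (w + 2) \<gamma> \<psi> k" "\<And>k. k \<le> m \<Longrightarrow> \<psi> k = ?\<chi> (Suc k)"
    by blast
  \<comment> \<open>Undoes the shift: a leading zero brings the weight back from
    \<open>w + 2\<close> to \<open>w\<close>.\<close>
  define \<theta> where "\<theta> = (\<lambda>k. case k of 0 \<Rightarrow> (\<lambda>z. 0) | Suc i \<Rightarrow> \<psi> i)"
  have law\<theta>: "jacobi_law w \<gamma> \<theta> k" if "\<gamma> \<in> \<Gamma>" for \<gamma> k
  proof (cases k)
    case 0
    then show ?thesis by (simp add: jacobi_law_def \<theta>_def)
  next
    case (Suc i)
    then show ?thesis using \<psi>(2)[OF that, of i]
      by (simp add: jacobi_law_Suc_iff \<theta>_def)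
  qed
  have hol\<theta>: "\<theta> k holomorphic_on upper_half_plane" for k
    using \<psi>(1) by (cases k) (auto simp: \<theta>_def)
  show ?case
  proof (intro exI[of _ "\<lambda>k z. \<theta> k z + ?C k z"] conjI allI ballI impI)
    show "(\<lambda>z. \<theta> k z + ?C k z) holomorphic_on upper_half_plane" for k
      by (intro holomorphic_on_add hol\<theta> C)
    show "jacobi_law w \<gamma> (\<lambda>k z. \<theta> k z + ?C k z) k" if "\<gamma> \<in> \<Gamma>" for \<gamma> k
      using that by (intro jacobi_law_add law\<theta> lawC)
    show "(\<lambda>z. \<theta> k z + ?C k z) = \<phi> k" if "k \<le> Suc m" for k
      using that \<psi>(3) by (cases k) (auto simp: \<theta>_def)
  qed
qed

section \<open>From the law to the two slash actions\<close>

text \<open>The sum in the law is a Cauchy product with \<open>fps_exp K\<close>, which cancels the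
  \<open>fps_exp (- K)\<close> of the action. Rescaling the variable removes the dependence of the
  power of \<open>J\<close> on \<open>k\<close>, and the remaining exponents -(w - 2\<delta>),
  -2\<delta> and w add up to 0.\<close>

lemma jacobi_slash_eq_if_jacobi_law:
  assumes \<gamma>: "det \<gamma> = 1" and z: "z \<in> upper_half_plane"
    and law: "\<And>k. jacobi_law w \<gamma> \<psi> k"
  shows "jacobi_slash (w - 2 * int \<delta>) (\<lambda>z. fps_X ^ \<delta> * Abs_fps (\<lambda>k. \<psi> k z)) \<gamma> z
    = fps_X ^ \<delta> * Abs_fps (\<lambda>k. \<psi> k z)"
proof -
  define J where "J = cocycle_J \<gamma> z"
  define K where "K = cocycle_K \<gamma> z"
  define P where "P = (\<lambda>z. Abs_fps (\<lambda>k. \<psi> k z))"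
  let ?c = "J powi (- 2)"
  have J: "J \<noteq> 0" unfolding J_def by (rule cocycle_J_nonzero[OF \<gamma> z])
  have comp: "P (mobius \<gamma> z) oo (fps_const ?c * fps_X) = fps_const (J powi w) * fps_exp K * P z"
  proof (rule fps_ext)
    fix k
    have "?c ^ k * J powi (w + 2 * int k) = J powi w"
      using J by (simp add: power_int_add power_int_minus power_int_mult field_simps
          power2_eq_square power_mult_distrib)
    moreover have "fps_nth (P (mobius \<gamma> z)) k =
        J powi (w + 2 * int k) * (\<Sum>j\<le>k. K ^ j / fact j * \<psi> (k - j) z)"
      using law[of k] z by (simp add: jacobi_law_def P_def J_def K_def)
    ultimately have "?c ^ k * fps_nth (P (mobius \<gamma> z)) k =
        J powi w * (\<Sum>j\<le>k. K ^ j / fact j * \<psi> (k - j) z)"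
      by (simp flip: mult.assoc)
    then show "fps_nth (P (mobius \<gamma> z) oo (fps_const ?c * fps_X)) k =
        fps_nth (fps_const (J powi w) * fps_exp K * P z) k"
      by (simp add: fps_nth_compose_linear mult.assoc fps_mult_nth[of "fps_exp K"] P_def
          atLeast0AtMost)
  qed
  have "(fps_X ^ \<delta> * P (mobius \<gamma> z)) oo (fps_const ?c * fps_X) =
      (fps_const ?c * fps_X) ^ \<delta> * (P (mobius \<gamma> z) oo (fps_const ?c * fps_X))"
    by (simp add: fps_compose_mult_distrib fps_X_power_compose)
  also have "\<dots> = fps_const (?c ^ \<delta> * J powi w) * fps_exp K * (fps_X ^ \<delta> * P z)"
    unfolding comp by (simp add: power_mult_distrib fps_const_power mult_ac flip: fps_const_mult)
  finally have "jacobi_slash (w - 2 * int \<delta>) (\<lambda>z. fps_X ^ \<delta> * P z) \<gamma> z =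
      fps_const (J powi (- (w - 2 * int \<delta>))) * fps_exp (- K) *
        (fps_const (?c ^ \<delta> * J powi w) * fps_exp K * (fps_X ^ \<delta> * P z))"
    by (simp only: jacobi_slash_def J_def K_def)
  also have "\<dots> = fps_const (J powi (- (w - 2 * int \<delta>)) * (?c ^ \<delta> * J powi w)) *
      (fps_exp (- K) * fps_exp K) * (fps_X ^ \<delta> * P z)"
    unfolding fps_const_mult[symmetric] by (simp only: mult_ac)
  also have "J powi (- (w - 2 * int \<delta>)) * (?c ^ \<delta> * J powi w) = 1"
    using J by (simp add: power_int_diff power_int_minus power_int_mult field_simps
        power2_eq_square power_mult_distrib)
  also have "fps_exp (- K) * fps_exp K = 1"
    by (simp flip: fps_exp_add_mult)
  finally show ?thesis by (simp add: P_def)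
qed

text \<open>The binomial theorem applied to each monomial. Summing up to a bound \<open>m\<close>
  instead of the degree gives a range independent of \<open>z\<close> in the application; for
  \<open>i < n\<close> the binomial coefficient is 0, so the truncated \<open>i - n\<close> is
  harmless.\<close>

lemma coeff_pcompose_linear:
  fixes p :: "'a::comm_ring_1 poly"
  assumes "degree p \<le> m"
  shows "coeff (pcompose p [:a, b:]) n =
    (\<Sum>i\<le>m. coeff p i * (of_nat (i choose n) * a ^ (i - n) * b ^ n))"
proof -
  have lin: "coeff ([:a, b:] ^ i) n = of_nat (i choose n) * a ^ (i - n) * b ^ n" for i
  proof (cases "n \<le> i")
    case True
    then show ?thesis by (simp add: coeff_linear_poly_power mult_ac)
  next
    case False
    have "degree ([:a, b:] ^ i) \<le> degree [:a, b:] * i" by (rule degree_power_le)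
    also have "\<dots> \<le> i" by simp
    finally show ?thesis using False by (simp add: coeff_eq_0 binomial_eq_0)
  qed
  have "pcompose (monom c i) [:a, b:] = smult c ([:a, b:] ^ i)" for c i
    by (simp add: pcompose_altdef map_poly_monom poly_monom)
  then have "pcompose (\<Sum>i\<le>m. monom (coeff p i) i) [:a, b:] =
      (\<Sum>i\<le>m. smult (coeff p i) ([:a, b:] ^ i))"
    by (simp add: pcompose_sum)
  then show ?thesis
    unfolding poly_as_sum_of_monoms'[OF assms] by (simp add: coeff_sum lin)
qed

text \<open>The substitution X \<mapsto> K + X/J^2 inverts X \<mapsto> J^2 (X - K), so invariance
  can be solved for \<open>F (mobius \<gamma> z)\<close> in terms of \<open>F z\<close>. Comparing
  coefficients of degree \<open>m - k\<close> then gives the law.\<close>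

lemma jacobi_law_if_poly_slash:
  assumes \<gamma>: "det \<gamma> = 1"
    and deg: "\<And>z. z \<in> upper_half_plane \<Longrightarrow> degree (F z) \<le> m"
    and inv: "\<And>z. z \<in> upper_half_plane \<Longrightarrow> poly_slash \<xi> F \<gamma> z = F z"
    and k: "k \<le> m"
  shows "jacobi_law (\<xi> - 2 * int m) \<gamma> (\<lambda>k z. fact (m - k) * coeff (F z) (m - k)) k"
  unfolding jacobi_law_def
proof
  fix z assume z: "z \<in> upper_half_plane"
  define J where "J = cocycle_J \<gamma> z"
  define K where "K = cocycle_K \<gamma> z"
  have J: "J \<noteq> 0" unfolding J_def by (rule cocycle_J_nonzero[OF \<gamma> z])
  have "F (mobius \<gamma> z) = smult (J powi \<xi>) (pcompose (F z) [:K, inverse (J\<^sup>2):])"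
  proof -
    have "pcompose (smult (J\<^sup>2) [:- K, 1:]) [:K, inverse (J\<^sup>2):] = [:0, 1:]"
      using J by (simp add: pcompose_pCons)
    then have "pcompose (pcompose (F (mobius \<gamma> z)) (smult (J\<^sup>2) [:- K, 1:])) [:K, inverse (J\<^sup>2):] =
        F (mobius \<gamma> z)"
      by (simp only: pcompose_assoc[symmetric] pcompose_idR)
    moreover have "F z = smult (J powi (- \<xi>)) (pcompose (F (mobius \<gamma> z)) (smult (J\<^sup>2) [:- K, 1:]))"
      using inv[OF z] by (simp only: poly_slash_def J_def K_def)
    ultimately have "pcompose (F z) [:K, inverse (J\<^sup>2):] = smult (J powi (- \<xi>)) (F (mobius \<gamma> z))"
      by (simp only: pcompose_smult)
    then show ?thesis using J by (simp add: power_int_minus)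
  qed
  then have "fact (m - k) * coeff (F (mobius \<gamma> z)) (m - k) = J powi \<xi> * inverse (J\<^sup>2) ^ (m - k) *
      (\<Sum>i\<le>m. fact (m - k) * of_nat (i choose (m - k)) * K ^ (i - (m - k)) * coeff (F z) i)"
    by (simp add: coeff_pcompose_linear[OF deg[OF z]] sum_distrib_left mult_ac)
  also have "(\<Sum>i\<le>m. fact (m - k) * of_nat (i choose (m - k)) * K ^ (i - (m - k)) * coeff (F z) i)
      = (\<Sum>i\<in>{m-k..m}. fact (m - k) * of_nat (i choose (m - k)) * K ^ (i - (m - k)) * coeff (F z) i)"
    by (rule sum.mono_neutral_right) (auto simp: binomial_eq_0)
  \<comment> \<open>Put i = m - k + j. Then (m - k)! times the binomial coefficient is i!/j!, and i
    = m - (k - j).\<close>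
  also have "\<dots> = (\<Sum>j\<le>k. K ^ j / fact j * (fact (m - (k - j)) * coeff (F z) (m - (k - j))))"
  proof (rule sum.reindex_bij_witness[of _ "\<lambda>j. m - k + j" "\<lambda>i. i - (m - k)"])
    fix i assume i: "i \<in> {m-k..m}"
    then have "m - (k - (i - (m - k))) = i" using k by auto
    moreover have "(of_nat (i choose (m - k)) :: complex) = fact i / (fact (m - k) * fact (i - (m - k)))"
      using i by (intro binomial_fact) auto
    ultimately show "K ^ (i - (m - k)) / fact (i - (m - k)) *
        (fact (m - (k - (i - (m - k)))) * coeff (F z) (m - (k - (i - (m - k))))) =
        fact (m - k) * of_nat (i choose (m - k)) * K ^ (i - (m - k)) * coeff (F z) i"
      by (simp only:) simp
  qed (use k in auto)
  also have "J powi \<xi> * inverse (J\<^sup>2) ^ (m - k) = J powi (\<xi> - 2 * int m + 2 * int k)"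
  proof -
    have e: "\<xi> - 2 * int m + 2 * int k = \<xi> - int (2 * (m - k))"
      using k by (simp add: of_nat_diff)
    show ?thesis
      unfolding e power_int_diff[OF disjI1[OF J]] power_int_of_nat power_mult
      by (simp add: divide_inverse power_inverse)
  qed
  finally show "fact (m - k) * coeff (F (mobius \<gamma> z)) (m - k) =
      cocycle_J \<gamma> z powi (\<xi> - 2 * int m + 2 * int k) *
      (\<Sum>j\<le>k. cocycle_K \<gamma> z ^ j / fact j * (fact (m - (k - j)) * coeff (F z) (m - (k - j))))"
    by (simp add: J_def K_def)
qed

section \<open>Lifting quasimodular polynomials to Jacobi-like forms\<close>

theorem theorem6p2:
  fixes \<Gamma> :: "(real^2^2) set" and m :: nat and \<xi> :: int
    and F :: "complex \<Rightarrow> complex poly"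
  assumes "discrete_subgroup_SL2R \<Gamma>"
    and "m > 0"
    and "\<xi> > 2 * int m"
    and "F \<in> quasimodular_polys m \<xi> \<Gamma>"
  shows "\<forall>\<delta>::nat. \<exists>\<Phi> \<in> jacobi_like_forms (\<xi> - 2 * int m - 2 * int \<delta>) \<Gamma> \<delta>.
           \<forall>z\<in>upper_half_plane. jacobi_proj \<delta> m \<Phi> z = F z"
proof
  fix \<delta> :: nat
  let ?w = "\<xi> - 2 * int m"
  \<comment> \<open>The factorial is chosen to cancel the \<open>1 / fact r\<close> in
    \<open>jacobi_proj\<close>, where r = m - k.\<close>
  let ?\<phi> = "\<lambda>k z. fact (m - k) * coeff (F z) (m - k)"
  have det: "det \<gamma> = 1" if "\<gamma> \<in> \<Gamma>" for \<gamma>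
    using assms(1) that subgroup.subset
    by (fastforce simp: discrete_subgroup_SL2R_def SL2R_def)
  have hol: "(\<lambda>z. coeff (F z) n) holomorphic_on upper_half_plane" for n
    using assms(4) by (auto simp: quasimodular_polys_def hol_poly_def)
  have deg: "degree (F z) \<le> m" if "z \<in> upper_half_plane" for z
    using assms(4) that by (auto simp: quasimodular_polys_def hol_poly_def)
  have inv: "poly_slash \<xi> F \<gamma> z = F z" if "\<gamma> \<in> \<Gamma>" "z \<in> upper_half_plane" for \<gamma> z
    using assms(4) that by (auto simp: quasimodular_polys_def)
  have "\<exists>\<psi>. (\<forall>k. \<psi> k holomorphic_on upper_half_plane) \<and>
      (\<forall>\<gamma>\<in>\<Gamma>. \<forall>k. jacobi_law ?w \<gamma> \<psi> k) \<and> (\<forall>k\<le>m. \<psi> k = ?\<phi> k)"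
  \<comment> \<open>The bound on \<open>\<xi>\<close> enters as \<open>?w > 0\<close>.\<close>
  proof (rule jacobi_law_extend)
    show "?\<phi> k holomorphic_on upper_half_plane" for k
      by (intro holomorphic_intros hol)
    show "jacobi_law ?w \<gamma> ?\<phi> k" if "\<gamma> \<in> \<Gamma>" "k \<le> m" for \<gamma> k
      by (rule jacobi_law_if_poly_slash[OF det[OF that(1)] deg inv[OF that(1)] that(2)])
  qed (use det assms(3) in auto)
  then obtain \<psi> where \<psi>: "\<And>k. \<psi> k holomorphic_on upper_half_plane"
    "\<And>\<gamma> k. \<gamma> \<in> \<Gamma> \<Longrightarrow> jacobi_law ?w \<gamma> \<psi> k" "\<And>k. k \<le> m \<Longrightarrow> \<psi> k = ?\<phi> k"
    by blast
  \<comment> \<open>The same \<open>\<psi>\<close> works for every \<open>\<delta>\<close>; only the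
    power of \<open>fps_X\<close> changes.\<close>
  let ?\<Phi> = "\<lambda>z. fps_X ^ \<delta> * Abs_fps (\<lambda>k. \<psi> k z)"
  have "?\<Phi> \<in> hol_fps_ge \<delta>"
    unfolding hol_fps_ge_def mem_Collect_eq
    by (rule bexI[of _ "\<lambda>z. Abs_fps (\<lambda>k. \<psi> k z)"]) (simp_all add: hol_fps_def \<psi>(1))
  moreover have "jacobi_slash (?w - 2 * int \<delta>) ?\<Phi> \<gamma> z = ?\<Phi> z"
    if "\<gamma> \<in> \<Gamma>" "z \<in> upper_half_plane" for \<gamma> z
    by (rule jacobi_slash_eq_if_jacobi_law[OF det[OF that(1)] that(2) \<psi>(2)[OF that(1)]])
  ultimately have "?\<Phi> \<in> jacobi_like_forms (?w - 2 * int \<delta>) \<Gamma> \<delta>"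
    by (simp add: jacobi_like_forms_def)
  moreover have "jacobi_proj \<delta> m ?\<Phi> z = F z" if "z \<in> upper_half_plane" for z
  proof -
    \<comment> \<open>Only indices m - r \<le> m are read, where \<open>\<psi>\<close> is
      prescribed.\<close>
    have "jacobi_proj \<delta> m ?\<Phi> z = (\<Sum>r\<le>m. monom (coeff (F z) r) r)"
      unfolding jacobi_proj_def
      by (rule sum.cong) (auto simp: fps_X_power_mult_nth \<psi>(3))
    also have "\<dots> = F z" by (rule poly_as_sum_of_monoms'[OF deg[OF that]])
    finally show ?thesis .
  qed
  ultimately show "\<exists>\<Phi>\<in>jacobi_like_forms (?w - 2 * int \<delta>) \<Gamma> \<delta>.
      \<forall>z\<in>upper_half_plane. jacobi_proj \<delta> m \<Phi> z = F z"
    by blast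
qed

end
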